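(* For all integers $n \ge 2$, $$\pi(n) \ge \frac{1}{2}\left(\frac{n}{\log n}\right) - \frac{1}{2}.$$
   Context: $\pi(x)$ is the number of primes $p \le x$; $\log$ is the natural logarithm. *)

theory Defs
  imports Complex_Main "HOL-Computational_Algebra.Primes"
begin

definition prime_pi :: "real \<Rightarrow> nat" where
  "prime_pi x = card {p::nat. prime p \<and> real p \<le> x}"

end

theory Submission
  imports Defs "HOL-Analysis.Harmonic_Numbers"
begin

text \<open>
  The proof compares two estimates of \<open>L = Lcm {1..n}\<close>, following Nair.

  The entries \<open>1 / ((n + 1) * (n choose k))\<close> of the Leibniz harmonic triangle are integer
  combinations of the unit fractions \<open>1, 1/2, \<dots>, 1/(n + 1)\<close> on its boundary, so every
  denominator \<open>(n + 1) * (n choose k)\<close> divides every common multiple of \<open>1, \<dots>, n + 1\<close>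
  (\<open>Suc_times_binomial_dvd\<close>). The central binomial coefficient is at least the average of its row,
  which makes the corresponding denominator at least \<open>2 ^ n\<close>; hence
  \<open>L \<ge> 2 ^ (n - 1)\<close> (\<open>two_power_le_Lcm\<close>).

  In the other direction, each prime power dividing \<open>L\<close> exactly already divides one of
  \<open>1, \<dots>, n\<close> and so is at most \<open>n\<close>; as only primes up to \<open>n\<close> occur, \<open>L \<le> n ^ \<pi>(n)\<close>
  (\<open>Lcm_le_power_card_primes\<close>).

  Taking logarithms gives \<open>(n - 1) * ln 2 \<le> \<pi>(n) * ln n\<close>. Together with \<open>ln 2 \<le> ln n\<close> and
  \<open>ln 2 \<ge> 2/3\<close> this yields the claim for all \<open>n \<ge> 2\<close>, without a separate treatment of small \<open>n\<close>.
\<close>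

text \<open>
  Writing \<open>T n k = (n + 1) * (n choose k)\<close>, the rule
  \<open>1 / T (n+1) (k+1) = 1 / T n k - 1 / T (n+1) k\<close> of the Leibniz triangle shows that the
  quotient \<open>M / T (n+1) (k+1)\<close> is a difference of two integers.
\<close>
lemma Suc_times_binomial_dvd:
  fixes M :: int
  assumes "k \<le> n" and "\<And>i. i \<in> {1..Suc n} \<Longrightarrow> int i dvd M"
  shows "int (Suc n * (n choose k)) dvd M"
  using assms
proof (induction k arbitrary: n)
  case 0
  from 0(2)[of "Suc n"] show ?case by simp
next
  case (Suc k)
  then obtain m where n: "n = Suc m" and "k \<le> m"
    by (cases n) auto
  define C where "C = int (n choose Suc k)"
  define D where "D = int (n choose k)"
  have "int (Suc m * (m choose k)) dvd M"
    using Suc.IH[of m] Suc.prems \<open>k \<le> m\<close> n by simp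
  moreover have "Suc m * (m choose k) = Suc k * (n choose Suc k)"
    using Suc_times_binomial[of k m] by (simp add: n)
  ultimately have "int (Suc k * (n choose Suc k)) dvd M"
    by (simp only:)
  then have "(int k + 1) * C dvd M"
    by (simp add: C_def algebra_simps)
  then obtain u where u: "M = (int k + 1) * C * u" ..
  have "int (Suc n * (n choose k)) dvd M"
    using Suc.IH[of n] Suc.prems \<open>k \<le> m\<close> n by simp
  then have "(int n + 1) * D dvd M"
    by (simp add: D_def algebra_simps)
  then obtain v where v: "M = (int n + 1) * D * v" ..
  have "Suc k * (n choose Suc k) = (n - k) * (n choose k)"
    using binomial_absorption[of k n] binomial_absorb_comp[of n k] by simp
  then have "int (Suc k * (n choose Suc k)) = int ((n - k) * (n choose k))"
    by (rule arg_cong)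
  then have CD: "(int k + 1) * C = (int n - int k) * D"
    using \<open>k \<le> m\<close> n
    by (simp only: of_nat_mult of_nat_diff C_def D_def of_nat_Suc le_SucI add.commute)
  \<comment> \<open>Multiplying by \<open>D\<close> clears the denominators in the rule above; here \<open>n\<close> stands for its \<open>n + 1\<close>,
    and \<open>u\<close>, \<open>v\<close> are the two integer quotients.\<close>
  have "D * ((int n + 1) * C * (u - v)) =
      ((int n - int k) * D) * C * u + D * ((int k + 1) * C * u) - C * ((int n + 1) * D * v)"
    by (simp add: algebra_simps)
  also have "\<dots> = C * M + D * M - C * M"
    unfolding CD[symmetric] u[symmetric] v[symmetric] using u by (simp add: mult_ac)
  finally have "D * ((int n + 1) * C * (u - v)) = D * M"
    by simp
  moreover have "D \<noteq> 0"
    using \<open>k \<le> m\<close> n by (simp add: D_def)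
  ultimately have "M = (int n + 1) * C * (u - v)"
    by simp
  then have "M = int (Suc n * (n choose Suc k)) * (u - v)"
    by (simp only: C_def of_nat_mult of_nat_Suc add.commute)
  then show ?case
    by (rule dvdI)
qed

lemma two_power_le_Suc_times_central_binomial:
  "2 ^ n \<le> Suc n * (n choose (n div 2))"
proof -
  have "2 ^ n = (\<Sum>k\<le>n. n choose k)"
    by (simp add: choose_row_sum)
  also have "\<dots> \<le> (\<Sum>k\<le>n. n choose (n div 2))"
    by (intro sum_mono binomial_maximum)
  finally show ?thesis
    by simp
qed

lemma two_power_le_Lcm:
  "2 ^ n \<le> Lcm {1..Suc n}"
proof -
  have "int (Suc n * (n choose (n div 2))) dvd int (Lcm {1..Suc n})"
  proof (rule Suc_times_binomial_dvd)
    show "int i dvd int (Lcm {1..Suc n})" if "i \<in> {1..Suc n}" for i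
      using dvd_Lcm[OF that] by (simp only: int_dvd_int_iff)
  qed simp
  then have "Suc n * (n choose (n div 2)) dvd Lcm {1..Suc n}"
    by (simp only: int_dvd_int_iff)
  moreover have "Lcm {1..Suc n} \<noteq> 0"
    by (simp add: Lcm_0_iff)
  ultimately have "Suc n * (n choose (n div 2)) \<le> Lcm {1..Suc n}"
    by (meson dvd_imp_le not_gr_zero)
  with two_power_le_Suc_times_central_binomial show ?thesis
    by (rule order_trans)
qed

text \<open>
  The \<open>p\<close>-adic valuation turns \<open>lcm\<close> into a maximum, and a maximum over a finite set is attained.
  For divisors other than prime powers this fails, as \<open>6 dvd Lcm {2, 3}\<close> shows.
\<close>
lemma prime_power_dvd_Lcm_imp_dvd:
  fixes p :: nat
  assumes "finite A" "prime p" "0 \<notin> A" "e > 0" "p ^ e dvd Lcm A"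
  shows "\<exists>a\<in>A. p ^ e dvd a"
  using assms
proof (induction A rule: finite_induct)
  case empty
  then show ?case by (auto simp: prime_nat_iff)
next
  case (insert a A)
  have nz: "a \<noteq> 0" "Lcm A \<noteq> 0"
    using insert.prems insert.hyps by (auto simp: Lcm_0_iff)
  have p: "\<not> is_unit p" "prime_elem p"
    using insert.prems by auto
  have "e \<le> multiplicity p (lcm a (Lcm A))"
    using insert.prems nz p by (simp add: power_dvd_iff_le_multiplicity lcm_eq_0_iff)
  also have "\<dots> = max (multiplicity p a) (multiplicity p (Lcm A))"
    using nz insert.prems by (simp add: multiplicity_lcm)
  finally have "p ^ e dvd a \<or> p ^ e dvd Lcm A"
    using nz p by (auto simp: power_dvd_iff_le_multiplicity)
  with insert show ?case by auto
qed

lemma Lcm_le_power_card_primes: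
  fixes n :: nat
  shows "Lcm {1..n} \<le> n ^ card {p. prime p \<and> p \<le> n}"
proof (cases "n = 0")
  case False
  define L where "L = Lcm {1..n}"
  have "L \<noteq> 0"
    by (simp add: L_def Lcm_0_iff)
  have bound: "p ^ multiplicity p L \<le> n" if p: "p \<in> prime_factors L" for p
  proof -
    have "\<exists>a\<in>{1..n}. p ^ multiplicity p L dvd a"
    proof (rule prime_power_dvd_Lcm_imp_dvd)
      show "multiplicity p L > 0"
        using p by (simp add: prime_factors_multiplicity)
    qed (use p multiplicity_dvd[of p L] in \<open>auto simp: L_def\<close>)
    then show ?thesis
      by (auto dest: dvd_imp_le)
  qed
  have "prime_factors L \<subseteq> {p. prime p \<and> p \<le> n}"
  proof
    fix p assume p: "p \<in> prime_factors L"
    then have "p dvd p ^ multiplicity p L"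
      by (simp add: prime_factors_multiplicity)
    moreover have "p ^ multiplicity p L > 0"
      using p by (auto intro: prime_gt_0_nat)
    ultimately have "p \<le> p ^ multiplicity p L"
      by (rule dvd_imp_le)
    with bound[OF p] p show "p \<in> {p. prime p \<and> p \<le> n}"
      by auto
  qed
  then have card: "card (prime_factors L) \<le> card {p. prime p \<and> p \<le> n}"
    by (intro card_mono) auto
  have "L = (\<Prod>p\<in>prime_factors L. p ^ multiplicity p L)"
    using \<open>L \<noteq> 0\<close> by (simp add: prod_prime_factors)
  also have "\<dots> \<le> (\<Prod>p\<in>prime_factors L. n)"
    by (intro prod_mono) (auto intro: bound)
  also have "\<dots> \<le> n ^ card {p. prime p \<and> p \<le> n}"
    using card False by (simp add: power_increasing)
  finally show ?thesis
    by (simp only: L_def)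
next
  case True
  then have "{p. prime p \<and> p \<le> n} = {}"
    by (auto simp: prime_nat_iff)
  then have "n ^ card {p. prime p \<and> p \<le> n} = 1"
    by (simp only: card.empty power_0)
  moreover have "Lcm {1..n} = 1"
    using True by simp
  ultimately show ?thesis
    by (simp only: order_refl)
qed

theorem mainTheorem14:
  fixes n :: nat
  assumes "n \<ge> 2"
  shows "real (prime_pi (real n)) \<ge> 1 / 2 * (real n / ln (real n)) - 1 / 2"
proof -
  define P where "P = prime_pi (real n)"
  have "2 ^ (n - 1) \<le> n ^ P"
    using order_trans[OF two_power_le_Lcm[of "n - 1"], of "n ^ P"] Lcm_le_power_card_primes[of n] assms
    by (simp add: P_def prime_pi_def)
  then have "(2::real) ^ (n - 1) \<le> real n ^ P"
    by (metis of_nat_le_iff of_nat_numeral of_nat_power)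
  then have "ln ((2::real) ^ (n - 1)) \<le> ln (real n ^ P)"
    using assms by (subst ln_le_cancel_iff) auto
  then have log_bound: "(real n - 1) * ln 2 \<le> real P * ln (real n)"
    using assms by (simp add: ln_realpow of_nat_diff)
  have ln_n: "ln 2 \<le> ln (real n)" "ln (real n) > 0"
    using assms by auto
  \<comment> \<open>The additional \<open>ln n / 2 \<ge> ln 2 / 2\<close> from the term \<open>-1/2\<close> of the claim turns the factor
    \<open>n - 1\<close> into \<open>n - 1/2\<close>, and \<open>(n - 1/2) * (2/3) \<ge> n/2\<close> is equivalent to \<open>n \<ge> 2\<close>.\<close>
  have "real n / 2 \<le> (real n - 1 / 2) * (2 / 3)"
    using assms by simp
  also have "\<dots> \<le> (real n - 1 / 2) * ln 2"
    using assms ln2_ge_two_thirds by (intro mult_left_mono) auto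
  also have "\<dots> = (real n - 1) * ln 2 + ln 2 / 2"
    by (simp add: algebra_simps)
  also have "\<dots> \<le> real P * ln (real n) + ln (real n) / 2"
    using log_bound ln_n by simp
  finally have "real n / 2 \<le> (real P + 1 / 2) * ln (real n)"
    by (simp add: algebra_simps)
  then have "real n / 2 / ln (real n) \<le> real P + 1 / 2"
    using ln_n by (simp add: pos_divide_le_eq)
  then show ?thesis
    by (simp add: P_def)
qed

end
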